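(* Let $T$ be a tree of order $n$ and let $k\geq 3$ be an integer such that $k<\mathrm{rad}(T)$. Then $$\gamma_{B_k}(T)\leq \left\lceil \frac{k+2}{k+1}\cdot\frac{n}{3}\right\rceil.$$
   Context: $d(u,v)$ denotes the distance in the graph; $\mathrm{rad}(T)$ is the radius (minimum eccentricity of a vertex). For a connected graph $G$ and an integer $k\ge 1$, a function $f\colon V(G)\to\{0,1,\dots,k\}$ is a dominating $k$-broadcast on $G$ if for every $u\in V(G)$ there is a vertex $v$ with $f(v)\geq 1$ and $d(u,v)\leq f(v)$. Its cost is $\omega(f)=\sum_{u\in V(G)}f(u)$, and the dominating $k$-broadcast number $\gamma_{B_k}(G)$ is the minimum cost of a dominating $k$-broadcast on $G$. *)

theory Defs
  imports Complex_Main
begin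

definition simple_graph :: "'a set \<Rightarrow> ('a \<Rightarrow> 'a \<Rightarrow> bool) \<Rightarrow> bool" where
  "simple_graph V E \<longleftrightarrow> finite V \<and> V \<noteq> {} \<and>
     (\<forall>u v. E u v \<longrightarrow> u \<in> V \<and> v \<in> V) \<and>
     (\<forall>u v. E u v \<longrightarrow> E v u) \<and> (\<forall>u. \<not> E u u)"

fun walk :: "('a \<Rightarrow> 'a \<Rightarrow> bool) \<Rightarrow> 'a list \<Rightarrow> bool" where
  "walk E [] = False"
| "walk E [x] = True"
| "walk E (x # y # xs) = (E x y \<and> walk E (y # xs))"

definition connected_graph :: "'a set \<Rightarrow> ('a \<Rightarrow> 'a \<Rightarrow> bool) \<Rightarrow> bool" where
  "connected_graph V E \<longleftrightarrow> (\<forall>u\<in>V. \<forall>v\<in>V. \<exists>xs. walk E xs \<and> hd xs = u \<and> last xs = v)"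

definition has_cycle :: "('a \<Rightarrow> 'a \<Rightarrow> bool) \<Rightarrow> bool" where
  "has_cycle E \<longleftrightarrow> (\<exists>xs. walk E xs \<and> distinct xs \<and> length xs \<ge> 3 \<and> E (last xs) (hd xs))"

definition tree :: "'a set \<Rightarrow> ('a \<Rightarrow> 'a \<Rightarrow> bool) \<Rightarrow> bool" where
  "tree V E \<longleftrightarrow> simple_graph V E \<and> connected_graph V E \<and> \<not> has_cycle E"

definition dist :: "('a \<Rightarrow> 'a \<Rightarrow> bool) \<Rightarrow> 'a \<Rightarrow> 'a \<Rightarrow> nat" where
  "dist E u v = (LEAST n. \<exists>xs. walk E xs \<and> hd xs = u \<and> last xs = v \<and> length xs = Suc n)"

definition eccentricity :: "'a set \<Rightarrow> ('a \<Rightarrow> 'a \<Rightarrow> bool) \<Rightarrow> 'a \<Rightarrow> nat" where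
  "eccentricity V E v = Max (dist E v ` V)"

definition radius :: "'a set \<Rightarrow> ('a \<Rightarrow> 'a \<Rightarrow> bool) \<Rightarrow> nat" where
  "radius V E = Min (eccentricity V E ` V)"

definition dominating_k_broadcast ::
  "'a set \<Rightarrow> ('a \<Rightarrow> 'a \<Rightarrow> bool) \<Rightarrow> nat \<Rightarrow> ('a \<Rightarrow> nat) \<Rightarrow> bool" where
  "dominating_k_broadcast V E k f \<longleftrightarrow>
     (\<forall>v\<in>V. f v \<le> k) \<and>
     (\<forall>u\<in>V. \<exists>v\<in>V. f v \<ge> 1 \<and> dist E u v \<le> f v)"

definition broadcast_cost :: "'a set \<Rightarrow> ('a \<Rightarrow> nat) \<Rightarrow> nat" where
  "broadcast_cost V f = (\<Sum>u\<in>V. f u)"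

definition broadcast_number :: "'a set \<Rightarrow> ('a \<Rightarrow> 'a \<Rightarrow> bool) \<Rightarrow> nat \<Rightarrow> nat" where
  "broadcast_number V E k =
     (LEAST c. \<exists>f. dominating_k_broadcast V E k f \<and> broadcast_cost V f = c)"

end

theory Submission
  imports Defs
begin

text \<open>Root the tree and call a vertex \<open>x\<close> reducible if its subtree \<open>T x\<close> of order \<open>N x\<close> is
  dominated, from inside, at cost at most \<open>(k + 2) / (k + 1) * N x / 3\<close>. The subtree of a reducible
  vertex can be cut off, so by induction on the order one may assume that there is none. Going up
  from the leaves, a count of vertices then gives \<open>3 h \<le> 2 N\<close> for the height and \<open>3 D \<le> 2 N + 2\<close> for the
  diameter of every subtree: the step works because \<open>N mod 3 \<noteq> 0\<close>, as otherwise a single ball of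
  radius \<open>N / 3\<close> would witness reducibility. In particular the whole tree has a ball of radius
  \<open>\<lceil>n / 3\<rceil>\<close> that covers it. The only obstacle is the limit \<open>k\<close> on the radius: it matters only if \<open>D > 2 k\<close>,
  and counting shows that this happens only for \<open>k = 3\<close> and \<open>k = 5\<close>, at vertices with a child
  subtree of order \<open>7\<close> or \<open>10\<close>, respectively, and height \<open>k\<close> that has a unique deepest vertex.
  Such vertices are reducible: use a ball of radius \<open>k\<close> and one unit on each deepest vertex.\<close>

section \<open>Walks, relation powers and distances\<close>

text \<open>Vertex lists are traded for powers of the edge relation, so that facts on
  \<open>^^\<close> serve to concatenate and split shortest paths.\<close>

lemma walk_relpowp:
  "(\<exists>xs. walk E xs \<and> hd xs = u \<and> last xs = v \<and> length xs = Suc n) \<longleftrightarrow> (E ^^ n) u v"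
proof (induction n arbitrary: u)
  case 0
  show ?case
  proof
    assume "\<exists>xs. walk E xs \<and> hd xs = u \<and> last xs = v \<and> length xs = Suc 0"
    then show "(E ^^ 0) u v" by (auto simp: length_Suc_conv)
  next
    assume "(E ^^ 0) u v"
    then have "walk E [u] \<and> hd [u] = u \<and> last [u] = v \<and> length [u] = Suc 0" by simp
    then show "\<exists>xs. walk E xs \<and> hd xs = u \<and> last xs = v \<and> length xs = Suc 0" by blast
  qed
next
  case (Suc n)
  show ?case
  proof
    assume "\<exists>xs. walk E xs \<and> hd xs = u \<and> last xs = v \<and> length xs = Suc (Suc n)"
    then obtain w ys where "walk E (u # w # ys)" "last (w # ys) = v" "length (w # ys) = Suc n"
      by (auto simp: length_Suc_conv)
    then have "E u w" "(E ^^ n) w v" using Suc.IH[of w] by (auto intro: exI[of _ "w # ys"])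
    then show "(E ^^ Suc n) u v" by (rule relpowp_Suc_I2)
  next
    assume "(E ^^ Suc n) u v"
    then obtain w where w: "E u w" "(E ^^ n) w v" by (rule relpowp_Suc_E2)
    then obtain xs where xs: "walk E xs" "hd xs = w" "last xs = v" "length xs = Suc n"
      using Suc.IH[of w] by blast
    then have "walk E (u # xs) \<and> hd (u # xs) = u \<and> last (u # xs) = v \<and> length (u # xs) = Suc (Suc n)"
      using w by (cases xs) auto
    then show "\<exists>xs. walk E xs \<and> hd xs = u \<and> last xs = v \<and> length xs = Suc (Suc n)" by blast
  qed
qed

lemma dist_eq_Least_relpowp: "dist E u v = (LEAST n. (E ^^ n) u v)"
  unfolding dist_def walk_relpowp ..

lemma dist_le_relpowp: "(E ^^ n) u v \<Longrightarrow> dist E u v \<le> n"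
  unfolding dist_eq_Least_relpowp by (rule Least_le)

lemma relpowp_sym: "(\<And>u v. E u v \<Longrightarrow> E v u) \<Longrightarrow> (E ^^ n) u v \<Longrightarrow> (E ^^ n) v u"
proof (induction n arbitrary: v)
  case (Suc n)
  from Suc.prems(2) obtain w where "(E ^^ n) u w" "E w v" by auto
  with Suc show ?case by (metis relpowp_Suc_I2)
qed simp

lemma walk_append:
  "xs \<noteq> [] \<Longrightarrow> ys \<noteq> [] \<Longrightarrow> walk E (xs @ ys) \<longleftrightarrow> walk E xs \<and> E (last xs) (hd ys) \<and> walk E ys"
proof (induction xs)
  case (Cons x xs)
  then show ?case by (cases xs; cases ys) auto
qed simp

lemma walk_rev: "(\<And>u v. E u v \<Longrightarrow> E v u) \<Longrightarrow> walk E xs \<Longrightarrow> walk E (rev xs)"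
proof (induction xs)
  case (Cons x xs)
  show ?case
  proof (cases "xs = []")
    case False
    then have "E x (hd xs)" "walk E xs" using Cons.prems(2) by (cases xs; simp)+
    then show ?thesis using False Cons by (simp add: walk_append last_rev)
  qed simp
qed simp

lemma walk_map_upt:
  "i < m \<Longrightarrow> (\<And>j. i \<le> j \<Longrightarrow> Suc j < m \<Longrightarrow> E (p j) (p (Suc j))) \<Longrightarrow> walk E (map p [i..<m])"
proof (induction m)
  case (Suc m)
  show ?case
  proof (cases "i < m")
    case True
    then obtain m' where m: "m = Suc m'" "i \<le> m'" by (cases m) auto
    have "E (p m') (p m)" using Suc.prems(2)[of m'] m by simp
    moreover have "last (map p [i..<m]) = p m'" using m by simp
    ultimately show ?thesis using True Suc by (simp add: walk_append)
  next
    case False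
    then have "i = m" using Suc.prems by simp
    then show ?thesis by simp
  qed
qed simp

section \<open>Distance and depth in a rooted tree\<close>

locale rooted_tree =
  fixes V :: "'a set" and E :: "'a \<Rightarrow> 'a \<Rightarrow> bool" and root :: 'a
  assumes tree: "tree V E" and root: "root \<in> V"
begin

abbreviation d :: "'a \<Rightarrow> 'a \<Rightarrow> nat" where "d \<equiv> dist E"
abbreviation depth :: "'a \<Rightarrow> nat" where "depth \<equiv> dist E root"

lemma finite_V: "finite V" and E_V: "E u v \<Longrightarrow> u \<in> V" "E u v \<Longrightarrow> v \<in> V"
  and E_sym: "E u v \<Longrightarrow> E v u" and E_irrefl: "\<not> E u u"
  and connected: "connected_graph V E" and acyclic: "\<not> has_cycle E"
  using tree unfolding tree_def simple_graph_def by blast+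

lemma dist_relpowp: assumes "u \<in> V" "v \<in> V" shows "(E ^^ d u v) u v"
proof -
  obtain xs where xs: "walk E xs" "hd xs = u" "last xs = v"
    using connected assms unfolding connected_graph_def by blast
  then have "(E ^^ (length xs - 1)) u v"
    by (subst walk_relpowp[symmetric]) (cases xs; auto)
  then show ?thesis unfolding dist_eq_Least_relpowp by (rule LeastI)
qed

lemma relpowp_V: "(E ^^ n) u v \<Longrightarrow> u \<in> V \<Longrightarrow> v \<in> V"
  by (cases n) (auto dest: E_V)

lemma d_self [simp]: "d u u = 0"
  using dist_le_relpowp[of 0 E u u] by simp

lemma d_eq_0: "u \<in> V \<Longrightarrow> v \<in> V \<Longrightarrow> d u v = 0 \<Longrightarrow> u = v"
  using dist_relpowp[of u v] by simp

lemma d_commute: assumes "u \<in> V" "v \<in> V" shows "d u v = d v u"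
proof -
  have "d b a \<le> d a b" if "a \<in> V" "b \<in> V" for a b
    by (rule dist_le_relpowp, rule relpowp_sym[OF _ dist_relpowp[OF that]]) (rule E_sym)
  then show ?thesis using assms by (simp add: antisym)
qed

lemma d_triangle: "u \<in> V \<Longrightarrow> v \<in> V \<Longrightarrow> w \<in> V \<Longrightarrow> d u w \<le> d u v + d v w"
  using dist_le_relpowp[of "d u v + d v w" E u w] dist_relpowp[of u v] dist_relpowp[of v w]
  by (auto simp: relpowp_add)

lemma d_edge: assumes "E u v" shows "d u v = 1"
proof -
  have "d u v \<le> 1" using assms by (intro dist_le_relpowp) (simp add: relcompp_apply)
  moreover have "d u v \<noteq> 0" using assms d_eq_0 E_V E_irrefl by blast
  ultimately show ?thesis by simp
qed

lemma between:
  assumes "u \<in> V" "v \<in> V" "i + j = d u v"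
  obtains w where "w \<in> V" "d u w = i" "d w v = j"
proof -
  have "(E ^^ (i + j)) u v" using dist_relpowp assms by simp
  then obtain w where w: "(E ^^ i) u w" "(E ^^ j) w v" by (auto simp: relpowp_add)
  then have "w \<in> V" using relpowp_V assms by blast
  moreover have "d u w \<le> i" "d w v \<le> j" using w by (auto intro: dist_le_relpowp)
  ultimately have "d u w = i \<and> d w v = j" using d_triangle[of u w v] assms by auto
  with that \<open>w \<in> V\<close> show ?thesis by blast
qed

lemma edge_of_d_1: "u \<in> V \<Longrightarrow> v \<in> V \<Longrightarrow> d u v = 1 \<Longrightarrow> E u v"
  using dist_relpowp[of u v] by (simp add: relcompp_apply)

text \<open>An edge changes the depth by at most one. Since \<open>depth a\<close> steps have to
  raise it from 0 to \<open>depth a\<close>, each of them raises it by exactly one.\<close>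

lemma root_geodesic:
  assumes "a \<in> V"
  obtains p where "p 0 = root" "p (depth a) = a" "\<And>i. i < depth a \<Longrightarrow> E (p i) (p (Suc i))"
    "\<And>i. i \<le> depth a \<Longrightarrow> depth (p i) = i"
proof -
  obtain p where p: "p 0 = root" "p (depth a) = a" "\<And>i. i < depth a \<Longrightarrow> E (p i) (p (Suc i))"
    using dist_relpowp[OF root assms] by (auto simp: relpowp_fun_conv)
  have V: "p i \<in> V" if "i \<le> depth a" for i
  proof (cases i)
    case (Suc j)
    then show ?thesis using p(3)[of j] that E_V(2) by simp
  qed (use p root in simp)
  have up: "depth (p i) \<le> i" if "i \<le> depth a" for i
    using that
  proof (induction i)
    case (Suc i)
    then show ?case using d_triangle[OF root V V, of i "Suc i"] d_edge[OF p(3), of i] by simp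
  qed (simp add: p)
  have down: "depth a \<le> depth (p (depth a - i)) + i" if "i \<le> depth a" for i
    using that
  proof (induction i)
    case (Suc i)
    let ?j = "depth a - Suc i"
    have "depth (p (Suc ?j)) \<le> depth (p ?j) + 1"
      using Suc.prems d_triangle[OF root V V, of ?j "Suc ?j"] d_edge[OF p(3), of ?j] by simp
    moreover have "Suc ?j = depth a - i" using Suc.prems by simp
    ultimately show ?case using Suc by simp
  qed (simp add: p)
  have "depth (p i) = i" if "i \<le> depth a" for i
    using up[OF that] down[of "depth a - i"] that by simp
  with that p show ?thesis by blast
qed

text \<open>Two geodesics from the root to distinct vertices of the same level, closed up by a path that
  meets this level and those above only in its ends, contain a cycle.\<close>

lemma same_level_not_joined:
  assumes ab: "a \<in> V" "b \<in> V" "a \<noteq> b" "depth a = depth b"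
    and mid: "\<And>c. c \<in> set mid \<Longrightarrow> depth c > depth a" "distinct mid"
    and walk: "walk E (a # mid @ [b])"
  shows False
proof -
  define m where "m = depth a"
  obtain p where p: "p 0 = root" "p m = a" "\<And>i. i < m \<Longrightarrow> E (p i) (p (Suc i))"
    "\<And>i. i \<le> m \<Longrightarrow> depth (p i) = i"
    using root_geodesic[OF ab(1)] unfolding m_def by metis
  obtain q where q: "q 0 = root" "q m = b" "\<And>i. i < m \<Longrightarrow> E (q i) (q (Suc i))"
    "\<And>i. i \<le> m \<Longrightarrow> depth (q i) = i"
    using root_geodesic[OF ab(2)] ab(4) unfolding m_def by metis
  \<comment> \<open>\<open>l\<close> will be the last level at which the two geodesics meet. A
    vertex on either of them has its depth as index, so they are disjoint beyond this level.\<close>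
  define S where "S = {i. i \<le> m \<and> p i = q i}"
  define l where "l = Max S"
  have fin: "finite S" unfolding S_def by simp
  have "0 \<in> S" unfolding S_def using p q by simp
  then have "l \<in> S" unfolding l_def using fin Max_in by blast
  then have l: "l \<le> m" "p l = q l" unfolding S_def by auto
  have "l \<noteq> m" using l p q ab by auto
  with l have lm: "l < m" by simp
  have differ: "p i \<noteq> q i" if "l < i" "i \<le> m" for i
  proof
    assume "p i = q i"
    then have "i \<in> S" unfolding S_def using that by simp
    then show False using Max_ge[OF fin] that unfolding l_def by fastforce
  qed
  \<comment> \<open>\<open>?Q\<close> starts one level below \<open>?P\<close>, so that the common
    vertex \<open>p l\<close> occurs only once in \<open>?C\<close>; the closing edge joins
    \<open>q (Suc l)\<close> to it.\<close>
  let ?P = "map p [l..<Suc m]" and ?Q = "map q [Suc l..<Suc m]"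
  let ?C = "?P @ mid @ rev ?Q"
  have P: "walk E ?P" "?P \<noteq> []" "last ?P = a" "hd ?P = p l"
  proof -
    show "walk E ?P" using lm p(3) by (intro walk_map_upt) auto
    show "?P \<noteq> []" "last ?P = a" using lm p(2) by simp_all
    show "hd ?P = p l" using lm by (simp add: hd_map del: upt_Suc)
  qed
  have Q: "walk E ?Q" "?Q \<noteq> []" "last ?Q = b" "hd ?Q = q (Suc l)"
  proof -
    show "walk E ?Q" using lm q(3) by (intro walk_map_upt) auto
    show "?Q \<noteq> []" "last ?Q = b" using lm q(2) by simp_all
    show "hd ?Q = q (Suc l)" using lm by (simp add: hd_map del: upt_Suc)
  qed
  have Q': "walk E (rev ?Q)" "rev ?Q \<noteq> []" "hd (rev ?Q) = b" "last (rev ?Q) = q (Suc l)"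
  proof -
    show "walk E (rev ?Q)" by (rule walk_rev[OF E_sym Q(1)])
    show "rev ?Q \<noteq> []" using Q(2) by (simp del: upt_Suc)
    show "hd (rev ?Q) = b" "last (rev ?Q) = q (Suc l)" using Q by (simp_all only: hd_rev last_rev)
  qed
  have "walk E ?C"
  proof (cases "mid = []")
    case True
    then have "E a b" using walk by simp
    then have "walk E (?P @ rev ?Q)" using P Q' by (subst walk_append) simp_all
    then show ?thesis using True by simp
  next
    case False
    then have "E a (hd mid)" "E (last mid) b" "walk E mid"
      using walk walk_append[of "[a]" "mid @ [b]"] by (auto simp: walk_append)
    then have "walk E (mid @ rev ?Q)" using Q' False by (subst walk_append) simp_all
    moreover have "hd (mid @ rev ?Q) = hd mid" using False by (rule hd_append2)
    ultimately show ?thesis using P \<open>E a (hd mid)\<close> False by (subst walk_append) simp_all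
  qed
  moreover have "distinct ?C"
  proof -
    have inj: "i = j" if "i \<le> m" "j \<le> m" "p i = p j" for i j using p(4) that by metis
    have inj': "i = j" if "i \<le> m" "j \<le> m" "q i = q j" for i j using q(4) that by metis
    have "distinct ?P" "distinct ?Q"
      unfolding distinct_map using inj inj' by (auto intro!: inj_onI simp del: upt_Suc)
    moreover have "set ?P \<inter> set ?Q = {}"
    proof -
      have "p i \<noteq> q j" if "l \<le> i" "i \<le> m" "l < j" "j \<le> m" for i j
        using differ[of j] p(4)[of i] q(4)[of j] that by metis
      then show ?thesis by (auto simp del: upt_Suc)
    qed
    moreover have "set mid \<inter> (set ?P \<union> set ?Q) = {}"
    proof -
      have le: "depth c \<le> m" if "c \<in> set ?P \<union> set ?Q" for c
        using that p(4) q(4) by (auto simp del: upt_Suc)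
      have "c \<notin> set ?P \<union> set ?Q" if "c \<in> set mid" for c
        using mid(1)[OF that] le[of c] unfolding m_def by (meson leD)
      then show ?thesis by blast
    qed
    ultimately show ?thesis using mid(2) by (auto simp del: upt_Suc)
  qed
  moreover have "length ?C \<ge> 3" using lm by simp
  moreover have "E (last ?C) (hd ?C)"
  proof -
    have "last ?C = q (Suc l)" using Q' by simp
    moreover have "hd ?C = p l" using P by (simp del: upt_Suc)
    ultimately show ?thesis using q(3)[of l] lm l E_sym by simp
  qed
  ultimately show False using acyclic unfolding has_cycle_def by blast
qed

text \<open>Edges within a level are excluded by \<open>same_level_not_joined\<close> with an empty
  middle part; the triangle inequality does the rest.\<close>

lemma edge_depth:
  assumes "E u v" shows "depth v = Suc (depth u) \<or> depth u = Suc (depth v)"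
proof -
  have "depth u \<noteq> depth v"
    using same_level_not_joined[of u v "[]"] assms E_V[OF assms] E_irrefl[of u] by auto
  moreover have "depth v \<le> depth u + 1" "depth u \<le> depth v + 1"
    using d_triangle[OF root, of u v] d_triangle[OF root, of v u] d_edge assms E_V E_sym by metis+
  ultimately show ?thesis by linarith
qed

lemma unique_parent:
  assumes "E a c" "E b c" "depth c = Suc (depth a)" "depth c = Suc (depth b)"
  shows "a = b"
proof (rule ccontr)
  assume "a \<noteq> b"
  then show False
    using same_level_not_joined[of a b "[c]"] assms E_V[OF assms(1)] E_V[OF assms(2)]
      E_sym[OF assms(2)] by simp
qed

section \<open>Subtrees: separation and decomposition\<close>

text \<open>The descendants of \<open>x\<close>, including \<open>x\<close>, given by distances in
  place of a parent function: \<open>v\<close> belongs to \<open>T x\<close> if some shortest path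
  from the root to \<open>v\<close> passes through \<open>x\<close>.\<close>

definition T :: "'a \<Rightarrow> 'a set" where
  "T x = {v \<in> V. depth v = depth x + d x v}"

definition children :: "'a \<Rightarrow> 'a set" where
  "children x = {y. E x y \<and> depth y = Suc (depth x)}"

lemma T_V: "T x \<subseteq> V" unfolding T_def by auto

lemma finite_T [simp]: "finite (T x)" using T_V finite_V finite_subset by blast

lemma T_self: "x \<in> V \<Longrightarrow> x \<in> T x" unfolding T_def by simp

lemma T_root: "T root = V" unfolding T_def by simp

lemma T_trans:
  assumes "x \<in> V" "y \<in> T x" "z \<in> T y" shows "z \<in> T x"
proof -
  have "y \<in> V" "z \<in> V" using assms T_V by auto
  then show ?thesis
    using assms d_triangle[OF root, of x z] d_triangle[of x y z] unfolding T_def by auto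
qed

text \<open>A neighbour of \<open>a\<close> one level down is a descendant of \<open>a\<close>,
  hence of \<open>z\<close>; so \<open>b\<close> is the parent of \<open>a\<close>. If
  \<open>a\<close> is not \<open>z\<close>, this parent lies on the path from \<open>z\<close> to
  \<open>a\<close>, hence in \<open>T z\<close>.\<close>

lemma T_exit:
  assumes z: "z \<in> V" and E: "E a b" and a: "a \<in> T z" and b: "b \<notin> T z"
  shows "a = z"
proof (rule ccontr)
  assume neq: "a \<noteq> z"
  have V: "a \<in> V" "b \<in> V" using E E_V by auto
  have dep: "depth a = depth z + d z a" using a unfolding T_def by simp
  show False
  proof (cases "depth b = Suc (depth a)")
    case True
    then have "b \<in> T a" unfolding T_def using V d_edge[OF E] by simp
    then show False using T_trans[OF z a] b by blast
  next
    case False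
    then have ba: "depth a = Suc (depth b)" using edge_depth[OF E] by simp
    obtain m where m: "d z a = Suc m" using neq d_eq_0[of z a] z V by (cases "d z a") auto
    then obtain w where w: "w \<in> V" "d z w = m" "d w a = 1"
      using between[of z a m 1] z V by auto
    have "depth w \<le> depth z + m" using d_triangle[OF root z w(1)] w by simp
    moreover have "depth a \<le> depth w + 1" using d_triangle[OF root w(1) V(1)] w by simp
    ultimately have dw: "depth w = depth z + m" "depth a = Suc (depth w)" using dep m by auto
    have "E w a" using w V edge_of_d_1 by simp
    then have "w = b" using unique_parent[of w a b] E E_sym dw ba by auto
    then show False using b w dw unfolding T_def by simp
  qed
qed

text \<open>By \<open>T_exit\<close>, a walk from \<open>T z\<close> to a vertex outside can leave
  \<open>T z\<close> only through \<open>z\<close>; the induction is on the length of the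
  walk.\<close>

lemma separator:
  assumes z: "z \<in> V" and u: "u \<in> T z" and w: "w \<in> V" "w \<notin> T z"
  shows "d u w = d u z + d z w"
proof -
  have uV: "u \<in> V" using u T_V by auto
  have "d u z + d z w \<le> n" if "(E ^^ n) u w" "u \<in> T z" for n u
    using that
  proof (induction n arbitrary: u)
    case (Suc n)
    then obtain v where v: "E u v" "(E ^^ n) v w" by (meson relpowp_Suc_E2)
    show ?case
    proof (cases "v \<in> T z")
      case True
      then show ?thesis
        using Suc.IH[OF v(2)] d_triangle[of u v z] d_edge[OF v(1)] E_V[OF v(1)] z by simp
    next
      case False
      then have "u = z" using T_exit[OF z v(1) Suc.prems(2)] by blast
      then show ?thesis using dist_le_relpowp[OF Suc.prems(1)] by simp
    qed
  qed (use w in auto)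
  from this[OF dist_relpowp u] have "d u z + d z w \<le> d u w" using uV w by blast
  then show ?thesis using d_triangle[of u z w] uV z w by simp
qed

lemma children_V: "y \<in> children x \<Longrightarrow> y \<in> V" unfolding children_def using E_V by blast

lemma finite_children [simp]: "finite (children x)"
  using children_V finite_V finite_subset[of "children x" V] by blast

lemma child_in_T: "y \<in> children x \<Longrightarrow> y \<in> T x"
  unfolding T_def using children_V[of y x] d_edge[of x y] by (auto simp: children_def)

lemma child_subtree: "x \<in> V \<Longrightarrow> y \<in> children x \<Longrightarrow> T y \<subseteq> T x"
  using T_trans child_in_T by blast

lemma d_child:
  assumes "x \<in> V" "y \<in> children x" "v \<in> T y" shows "d x v = Suc (d y v)"
proof -
  have "v \<in> T x" using assms child_subtree by blast
  then show ?thesis using assms unfolding T_def children_def by simp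
qed

lemma root_not_in_child: "x \<in> V \<Longrightarrow> y \<in> children x \<Longrightarrow> x \<notin> T y"
  using d_child[of x y x] by auto

lemma T_decomp:
  assumes x: "x \<in> V" shows "T x = insert x (\<Union>y\<in>children x. T y)"
proof
  show "T x \<subseteq> insert x (\<Union>y\<in>children x. T y)"
  proof
    fix v assume v: "v \<in> T x"
    then have vV: "v \<in> V" and dep: "depth v = depth x + d x v" unfolding T_def by auto
    show "v \<in> insert x (\<Union>y\<in>children x. T y)"
    proof (cases "d x v")
      case 0
      then show ?thesis using d_eq_0 x vV by auto
    next
      case (Suc m)
      then obtain y where y: "y \<in> V" "d x y = 1" "d y v = m" using between[of x v 1 m] x vV by auto
      have "depth y \<le> depth x + 1" using d_triangle[OF root x y(1)] y by simp
      moreover have "depth v \<le> depth y + m" using d_triangle[OF root y(1) vV] y by simp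
      ultimately have "depth y = Suc (depth x)" using dep Suc by simp
      then have "y \<in> children x" "v \<in> T y"
        using edge_of_d_1 x y vV dep Suc unfolding children_def T_def by auto
      then show ?thesis by blast
    qed
  qed
  show "insert x (\<Union>y\<in>children x. T y) \<subseteq> T x" using child_subtree T_self x by blast
qed

text \<open>Siblings have the same depth, so neither is below the other, and a common descendant
  \<open>v\<close> is equally far from both. But \<open>separator\<close> makes it farther from
  \<open>z\<close> than from \<open>y\<close>.\<close>

lemma children_disjoint:
  assumes x: "x \<in> V" and y: "y \<in> children x" and z: "z \<in> children x" and "y \<noteq> z"
  shows "T y \<inter> T z = {}"
proof (rule ccontr)
  assume "T y \<inter> T z \<noteq> {}"
  then obtain v where v: "v \<in> T y" "v \<in> T z" by blast
  have V: "y \<in> V" "z \<in> V" "v \<in> V" using y z v children_V T_V by auto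
  have "z \<notin> T y"
  proof
    assume "z \<in> T y"
    then have "d y z = 0" using y z unfolding T_def children_def by simp
    then show False using d_eq_0 V \<open>y \<noteq> z\<close> by blast
  qed
  then have "d v z = d v y + d y z" using separator[OF V(1) v(1) V(2)] by simp
  moreover have "d v z = d v y"
    using v y z d_commute[of v y] d_commute[of v z] V unfolding T_def children_def by simp
  ultimately show False using d_eq_0 V \<open>y \<noteq> z\<close> by auto
qed

section \<open>Order, height and diameter of a subtree\<close>

definition N :: "'a \<Rightarrow> nat" where "N x = card (T x)"

definition h :: "'a \<Rightarrow> nat" where "h x = Max (d x ` T x)"

lemma N_decomp:
  assumes "x \<in> V" shows "N x = Suc (\<Sum>y\<in>children x. N y)"
proof -
  have "N x = Suc (card (\<Union>y\<in>children x. T y))"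
    unfolding N_def T_decomp[OF assms] using root_not_in_child[OF assms] by (subst card_insert_disjoint) auto
  also have "card (\<Union>y\<in>children x. T y) = (\<Sum>y\<in>children x. N y)"
    unfolding N_def using children_disjoint[OF assms] by (intro card_UN_disjoint) auto
  finally show ?thesis .
qed

lemma N_pos: "x \<in> V \<Longrightarrow> N x \<ge> 1"
  using N_decomp by simp

lemma sum_N_le: "x \<in> V \<Longrightarrow> C \<subseteq> children x \<Longrightarrow> Suc (\<Sum>y\<in>C. N y) \<le> N x"
  using N_decomp[of x] sum_mono2[of "children x" C N] by simp

lemma N_child: "x \<in> V \<Longrightarrow> y \<in> children x \<Longrightarrow> N y + 1 \<le> N x"
  using sum_N_le[of x "{y}"] by simp

lemma N_children:
  "x \<in> V \<Longrightarrow> y \<in> children x \<Longrightarrow> z \<in> children x \<Longrightarrow> y \<noteq> z \<Longrightarrow> N y + N z + 1 \<le> N x"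
  using sum_N_le[of x "{y, z}"] by simp

lemma d_le_h: "v \<in> T x \<Longrightarrow> d x v \<le> h x"
  unfolding h_def by simp

lemma h_attained: assumes "x \<in> V" obtains v where "v \<in> T x" "d x v = h x"
proof -
  have "h x \<in> d x ` T x" unfolding h_def using T_self[OF assms] by (intro Max_in) auto
  then show ?thesis using that by force
qed

lemma h_child: assumes "x \<in> V" "y \<in> children x" shows "Suc (h y) \<le> h x"
proof -
  obtain v where "v \<in> T y" "d y v = h y" using h_attained assms children_V by blast
  then show ?thesis using d_child[OF assms] d_le_h[of v x] child_subtree[OF assms] by auto
qed

lemma tallest_child:
  assumes x: "x \<in> V" and h: "h x = Suc m" obtains y where "y \<in> children x" "h y = m"
proof -
  obtain v where v: "v \<in> T x" "d x v = Suc m" using h_attained[OF x] h by metis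
  then have "v \<noteq> x" by auto
  then obtain y where y: "y \<in> children x" "v \<in> T y" using v T_decomp[OF x] by blast
  then have "m \<le> h y" using d_child[OF x y] v d_le_h[of v y] by simp
  then have "h y = m" using h_child[OF x y(1)] h by simp
  with y that show ?thesis by blast
qed

text \<open>The case distinction by which bounds on distances pass from the children to
  \<open>x\<close>: a pair from two child subtrees, or with \<open>x\<close> as one end, is measured
  through \<open>x\<close>; a pair inside one child subtree is left to the bound for that
  child.\<close>

lemma pair_cases:
  assumes x: "x \<in> V" and uv: "u \<in> T x" "v \<in> T x"
  obtains (root) "u = x" "v = x"
  | (path) c where "c \<in> children x" "d u v \<le> h c + 1"
  | (child) c where "c \<in> children x" "u \<in> T c" "v \<in> T c"
  | (two) y z where "y \<in> children x" "z \<in> children x" "y \<noteq> z" "d u v \<le> h y + h z + 2"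
proof -
  have V: "u \<in> V" "v \<in> V" using uv T_V by auto
  have up: "d x w \<le> h c + 1" if "c \<in> children x" "w \<in> T c" for c w
    using d_child[OF x that] d_le_h[OF that(2)] by simp
  consider "u = x" "v = x" | c where "c \<in> children x" "u = x" "v \<in> T c"
    | c where "c \<in> children x" "v = x" "u \<in> T c"
    | y z where "y \<in> children x" "z \<in> children x" "u \<in> T y" "v \<in> T z"
    using uv T_decomp[OF x] by blast
  then show ?thesis
  proof cases
    case 1 then show ?thesis using root by blast
  next
    case 2 then show ?thesis using path up by blast
  next
    case 3 then show ?thesis using path[of c] up[of c u] d_commute[of u x] V x by auto
  next
    case 4
    show ?thesis
    proof (cases "y = z")
      case True then show ?thesis using child 4 by blast
    next
      case False
      have "d u v \<le> d u x + d x v" using d_triangle V x by blast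
      also have "\<dots> \<le> h y + h z + 2"
        using up[OF 4(1,3)] up[OF 4(2,4)] d_commute[of u x] V x by simp
      finally show ?thesis using two False 4 by blast
    qed
  qed
qed

text \<open>The centre lies at distance \<open>r\<close> above a deepest vertex \<open>w\<close>: vertices below it are at
  most as deep as \<open>w\<close>, the others are separated from \<open>w\<close> by it.\<close>

lemma subtree_center:
  assumes x: "x \<in> V" and diam: "\<And>u v. u \<in> T x \<Longrightarrow> v \<in> T x \<Longrightarrow> d u v \<le> 2 * r"
  obtains z where "z \<in> T x" "\<And>u. u \<in> T x \<Longrightarrow> d u z \<le> r"
proof (cases "h x \<le> r")
  case True
  have "d u x \<le> r" if "u \<in> T x" for u
    using d_le_h[OF that] True d_commute[of u x] that T_V x by fastforce
  then show ?thesis using that T_self[OF x] by blast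
next
  case False
  obtain w where w: "w \<in> T x" "d x w = h x" using h_attained[OF x] .
  have wV: "w \<in> V" using w T_V by auto
  obtain z where z: "z \<in> V" "d x z = h x - r" "d z w = r"
    using between[of x w "h x - r" r] x wV w False by auto
  have depw: "depth w = depth x + h x" using w unfolding T_def by simp
  have depz: "depth z = depth x + (h x - r)"
    using d_triangle[OF root x z(1)] d_triangle[OF root z(1) wV] z depw False by simp
  have zT: "z \<in> T x" and wz: "w \<in> T z" unfolding T_def using z wV depz depw False by auto
  have "d u z \<le> r" if u: "u \<in> T x" for u
  proof -
    have uV: "u \<in> V" using u T_V by auto
    have "d z u \<le> r"
    proof (cases "u \<in> T z")
      case True
      then have "depth u = depth z + d z u" unfolding T_def by simp
      moreover have "depth u = depth x + d x u" using u unfolding T_def by simp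
      ultimately show ?thesis using d_le_h[OF u] depz False by simp
    next
      case False
      then have "d w u = d w z + d z u" using separator[OF z(1) wz uV] by simp
      then show ?thesis using diam[OF w(1) u] z d_commute[OF wV z(1)] by simp
    qed
    then show ?thesis using d_commute[OF uV z(1)] by simp
  qed
  then show ?thesis using that zT by blast
qed

section \<open>Reducible subtrees: balls and removal\<close>

text \<open>The last inequality is the cost bound \<open>(k + 2) / (k + 1) * N x / 3\<close> cleared
  of denominators. Since \<open>g\<close> vanishes outside \<open>T x\<close> and dominates
  \<open>T x\<close> from inside, it can be glued to a broadcast on the rest of the tree.\<close>

definition reducible :: "nat \<Rightarrow> 'a \<Rightarrow> bool" where
  "reducible k x \<longleftrightarrow> (\<exists>g. (\<forall>v. v \<notin> T x \<longrightarrow> g v = 0) \<and> (\<forall>v. g v \<le> k) \<and>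
     (\<forall>u\<in>T x. \<exists>v\<in>T x. 1 \<le> g v \<and> d u v \<le> g v) \<and>
     3 * (k + 1) * sum g (T x) \<le> (k + 2) * N x)"

lemma ball_broadcast:
  assumes x: "x \<in> V" and r: "1 \<le> r" "r \<le> k"
    and diam: "\<And>u v. u \<in> T x \<Longrightarrow> v \<in> T x \<Longrightarrow> d u v \<le> 2 * r"
  obtains g where "\<And>v. v \<notin> T x \<Longrightarrow> g v = 0" "\<And>v. g v \<le> k"
    "\<And>u. u \<in> T x \<Longrightarrow> \<exists>v\<in>T x. 1 \<le> g v \<and> d u v \<le> g v" "sum g (T x) = r"
proof -
  obtain z where z: "z \<in> T x" "\<And>u. u \<in> T x \<Longrightarrow> d u z \<le> r"
    using subtree_center[OF x diam] by blast
  show ?thesis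
    by (rule that[of "\<lambda>v. if v = z then r else 0"]) (use z r in \<open>auto intro!: bexI[of _ z]\<close>)
qed

lemma reducible_ball:
  assumes "x \<in> V" "1 \<le> r" "r \<le> k"
    and "\<And>u v. u \<in> T x \<Longrightarrow> v \<in> T x \<Longrightarrow> d u v \<le> 2 * r"
    and "3 * (k + 1) * r \<le> (k + 2) * N x"
  shows "reducible k x"
  using ball_broadcast[OF assms(1-4)] assms(5) unfolding reducible_def by metis

text \<open>Acyclicity is inherited. For connectedness, all ancestors of a vertex outside
  \<open>T x\<close> are outside as well, so its path from the root survives.\<close>

lemma remove_subtree:
  assumes x: "x \<in> V" "x \<noteq> root"
  defines "E' \<equiv> \<lambda>u v. E u v \<and> u \<notin> T x \<and> v \<notin> T x"
  shows "tree (V - T x) E'"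
proof -
  have sub: "walk E xs" if "walk E' xs" for xs
    using that by (induction xs rule: induct_list012) (auto simp: E'_def)
  have rootx: "root \<notin> T x"
  proof
    assume "root \<in> T x"
    then have "depth x = 0" unfolding T_def by simp
    then show False using d_eq_0[OF root x(1)] x by simp
  qed
  have out: "a \<notin> T x" if "a \<in> V" "b \<in> V" "b \<notin> T x" "depth b = depth a + d a b" for a b
    using T_trans[OF x(1), of a b] that unfolding T_def[of a] by blast
  have reach: "(E' ^^ n) root v" if "v \<in> V" "v \<notin> T x" "depth v = n" for v n
    using that
  proof (induction n arbitrary: v)
    case 0
    then show ?case using d_eq_0[OF root] by simp
  next
    case (Suc n)
    then obtain w where w: "w \<in> V" "depth w = n" "d w v = 1"
      using between[of root v n 1] root by auto
    then have "w \<notin> T x" using out[of w v] Suc.prems by simp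
    then have "(E' ^^ n) root w" "E' w v"
      using Suc w edge_of_d_1[of w v] unfolding E'_def by auto
    then show ?case by auto
  qed
  have sym: "E' v u" if "E' u v" for u v using that E_sym unfolding E'_def by blast
  have "connected_graph (V - T x) E'"
    unfolding connected_graph_def
  proof (intro ballI)
    fix u v assume u: "u \<in> V - T x" and v: "v \<in> V - T x"
    have "(E' ^^ depth u) u root" using relpowp_sym[OF sym reach[OF _ _ refl]] u by blast
    moreover have "(E' ^^ depth v) root v" using reach v by blast
    ultimately have "(E' ^^ (depth u + depth v)) u v" by (auto simp: relpowp_add)
    then show "\<exists>xs. walk E' xs \<and> hd xs = u \<and> last xs = v" using walk_relpowp by metis
  qed
  moreover have "simple_graph (V - T x) E'"
    unfolding simple_graph_def using finite_V rootx root E_V E_sym E_irrefl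
    by (auto simp: E'_def)
  moreover have "\<not> has_cycle E'"
    using acyclic sub unfolding has_cycle_def E'_def by blast
  ultimately show ?thesis unfolding tree_def by blast
qed

end

section \<open>Arithmetic modulo 3\<close>

text \<open>With \<open>n\<close> also \<open>2 * n\<close> is not divisible by 3, so any inequality
  between \<open>2 * n\<close> and a multiple of 3 is strict.\<close>

lemma mod_3_nonzero:
  fixes n m :: nat
  assumes "n mod 3 \<noteq> 0"
  shows "n mod 3 = 1 \<or> n mod 3 = 2" "3 * m \<le> 2 * n \<Longrightarrow> 3 * m + 1 \<le> 2 * n"
    "2 * n \<le> 3 * m + 3 \<Longrightarrow> 2 * n \<le> 3 * m + 2"
  using assms by presburger+

lemma mod_3_eq_1: "n mod 3 = 1 \<Longrightarrow> 3 * m \<le> 2 * n \<Longrightarrow> 3 * m + 2 \<le> 2 * n" for n m :: nat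
  by presburger

text \<open>The arithmetic of \<open>exceptional_subtree\<close>: \<open>x\<close>,
  \<open>w\<close>, \<open>y\<close> form a chain of tallest children, and \<open>z\<close> is a
  sibling of \<open>w\<close>. The bounds on \<open>ny\<close> and \<open>hy\<close> give
  \<open>3 * (k - 2) + 1 \<le> 2 * k\<close>, so \<open>k \<le> 5\<close>; the residue of
  \<open>ny\<close> then excludes \<open>k = 4\<close>.\<close>

lemma exceptional_numbers:
  fixes k :: nat
  assumes "k \<ge> 3" and y: "ny \<le> k" "ny mod 3 = 2" "3 * hy + 1 \<le> 2 * ny" "k \<le> hy + 2"
    and w: "hw = Suc hy" "3 * hw + 2 = 2 * nw" and z: "3 * hz + 1 = 2 * nz"
    and x: "nx = nw + nz + 1" "nx \<le> 2 * k + 1" "nx mod 3 = 1"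
  shows "Suc hw = k \<and> (k = 3 \<and> nx = 7 \<or> k = 5 \<and> nx = 10) \<and> hz < hw"
proof -
  have "k \<le> 5" using y by linarith
  then consider "k = 3" | "k = 4" | "k = 5" using assms(1) by linarith
  then show ?thesis
  proof cases
    case 1
    then have "ny = 2" using y(1,2) by presburger
    then have "hy = 1" using y 1 by linarith
    then have "nw = 4" "hw = 2" using w by auto
    then show ?thesis using z x 1 by presburger
  next
    case 2
    then have "ny = 2" using y(1,2) by presburger
    then show ?thesis using y(3,4) 2 by linarith
  next
    case 3
    then have "ny = 2 \<or> ny = 5" using y(1,2) by presburger
    then have "hy = 3" using y 3 by linarith
    then have "nw = 7" "hw = 4" using w by auto
    then show ?thesis using z x 3 by presburger
  qed
qed

section \<open>Tight subtrees in a tree without reducible vertices\<close>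

locale irreducible_tree = rooted_tree +
  fixes k :: nat
  assumes k: "k \<ge> 3" and irreducible: "\<And>x. x \<in> V \<Longrightarrow> \<not> reducible k x"
begin

text \<open>The invariant carried up from the leaves. A step to the parent may add 3 to
  \<open>3 * h x\<close> but only 2 to \<open>2 * N x\<close>; the missing unit comes from the
  residue condition, which makes the height bound strict. The bound \<open>2 * k\<close> lets balls
  of radius \<open>k\<close> suffice.\<close>

definition tight :: "'a \<Rightarrow> bool" where
  "tight x \<longleftrightarrow> N x mod 3 \<noteq> 0 \<and> 3 * h x \<le> 2 * N x \<and>
     (\<forall>u\<in>T x. \<forall>v\<in>T x. 3 * d u v \<le> 2 * N x + 2 \<and> d u v \<le> 2 * k)"

lemma tight_simps:
  assumes "tight x" shows "N x mod 3 \<noteq> 0" "3 * h x \<le> 2 * N x"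
  using assms unfolding tight_def by auto

lemma tight_h: "tight x \<Longrightarrow> 3 * h x + 1 \<le> 2 * N x"
  using mod_3_nonzero(2) tight_simps by blast

lemma tight_h_mod_1: "tight x \<Longrightarrow> N x mod 3 = 1 \<Longrightarrow> 3 * h x + 2 \<le> 2 * N x"
  using mod_3_eq_1 tight_simps(2) by blast

lemma tight_mod_cases: "tight x \<Longrightarrow> N x mod 3 = 1 \<or> N x mod 3 = 2"
  using mod_3_nonzero(1) tight_simps(1) by blast

text \<open>A covering ball within the budget would make \<open>x\<close> reducible. If
  \<open>r\<close> exceeds \<open>k\<close>, the cheaper ball of radius \<open>k\<close> still
  covers \<open>T x\<close>, as the diameter is at most \<open>2 * k\<close>.\<close>

lemma no_cheap_ball:
  assumes x: "x \<in> V" and r: "r \<ge> 1"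
    and diam: "\<And>u v. u \<in> T x \<Longrightarrow> v \<in> T x \<Longrightarrow> d u v \<le> 2 * r \<and> d u v \<le> 2 * k"
  shows "(k + 2) * N x < 3 * (k + 1) * r"
proof (rule ccontr)
  assume "\<not> ?thesis"
  then have le: "3 * (k + 1) * r \<le> (k + 2) * N x" by simp
  have "3 * (k + 1) * min r k \<le> 3 * (k + 1) * r" by (rule mult_le_mono2) simp
  with le have "3 * (k + 1) * min r k \<le> (k + 2) * N x" by (rule order_trans[rotated])
  then have "reducible k x"
    using reducible_ball[of x "min r k" k] x r k diam by (auto simp: min_def)
  then show False using irreducible x by blast
qed

text \<open>By tightness the radius \<open>(N x + 1) / 3\<close> suffices, and its being too
  expensive means \<open>(k + 2) * N x < (k + 1) * (N x + 1)\<close>.\<close>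

lemma N_le_mod_2:
  assumes x: "x \<in> V" "tight x" and mod: "N x mod 3 = 2"
  shows "N x \<le> k"
proof -
  define r where "r = N x div 3 + 1"
  have Nr: "N x + 1 = 3 * r" using mod unfolding r_def by presburger
  have "d u v \<le> 2 * r \<and> d u v \<le> 2 * k" if "u \<in> T x" "v \<in> T x" for u v
  proof -
    have "3 * d u v \<le> 2 * N x + 2" "d u v \<le> 2 * k" using x that unfolding tight_def by auto
    then show ?thesis using Nr by linarith
  qed
  then have "(k + 2) * N x < 3 * (k + 1) * r"
    using no_cheap_ball[OF x(1), of r] unfolding r_def by auto
  also have "3 * (k + 1) * r = (k + 1) * (N x + 1)" using Nr by (simp only: mult.assoc mult.left_commute)
  finally show ?thesis by (simp add: algebra_simps)
qed

text \<open>As before, with the radius \<open>(N x + 2) / 3\<close>.\<close>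

lemma N_le_mod_1:
  assumes x: "x \<in> V" "tight x" and mod: "N x mod 3 = 1"
  shows "N x \<le> 2 * k + 1"
proof -
  define r where "r = N x div 3 + 1"
  have Nr: "N x + 2 = 3 * r" using mod unfolding r_def by presburger
  have "d u v \<le> 2 * r \<and> d u v \<le> 2 * k" if "u \<in> T x" "v \<in> T x" for u v
  proof -
    have "3 * d u v \<le> 2 * N x + 2" "d u v \<le> 2 * k" using x that unfolding tight_def by auto
    then show ?thesis using Nr by linarith
  qed
  then have "(k + 2) * N x < 3 * (k + 1) * r"
    using no_cheap_ball[OF x(1), of r] unfolding r_def by auto
  also have "3 * (k + 1) * r = (k + 1) * (N x + 2)" using Nr by (simp only: mult.assoc mult.left_commute)
  finally show ?thesis by (simp add: algebra_simps)
qed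

text \<open>Otherwise the radius \<open>(N x - 1) / 3\<close>, rounded down this time, would
  suffice, and its cost is within the budget. Order 1 is excluded because this radius has to be
  positive.\<close>

lemma far_pair_mod_1:
  assumes x: "x \<in> V" "tight x" and mod: "N x mod 3 = 1" and "N x \<noteq> 1"
  obtains u v where "u \<in> T x" "v \<in> T x" "3 * d u v \<ge> 2 * N x + 1"
proof (rule ccontr)
  note far = that
  assume none: "\<not> thesis"
  have near: "3 * d u v \<le> 2 * N x" if uv: "u \<in> T x" "v \<in> T x" for u v
  proof (rule ccontr)
    assume "\<not> ?thesis"
    then have "3 * d u v \<ge> 2 * N x + 1" by simp
    then show False using far[OF uv] none by blast
  qed
  define r where "r = N x div 3"
  have Nr: "N x = 3 * r + 1" "r \<ge> 1" using mod \<open>N x \<noteq> 1\<close> unfolding r_def by presburger+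
  have "d u v \<le> 2 * r \<and> d u v \<le> 2 * k" if "u \<in> T x" "v \<in> T x" for u v
    using near[OF that] x that Nr unfolding tight_def by fastforce
  then have "(k + 2) * N x < 3 * (k + 1) * r" using no_cheap_ball[OF x(1) Nr(2)] by blast
  then show False unfolding Nr by (simp add: algebra_simps)
qed

text \<open>Here the pair of children through which a longest path runs may be assumed to contain
  any prescribed tallest child \<open>w\<close>.\<close>

lemma far_children_mod_1:
  assumes x: "x \<in> V" "tight x" and mod: "N x mod 3 = 1"
    and ch: "\<And>c. c \<in> children x \<Longrightarrow> tight c"
    and w: "w \<in> children x" "h x = Suc (h w)"
  obtains z where "z \<in> children x" "z \<noteq> w" "3 * (h w + h z + 2) \<ge> 2 * N x + 1"
proof -
  have "N x \<noteq> 1" using N_child[OF x(1) w(1)] N_pos[OF children_V[OF w(1)]] by simp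
  then obtain u v where uv: "u \<in> T x" "v \<in> T x" "3 * d u v \<ge> 2 * N x + 1"
    using far_pair_mod_1[OF x mod] by blast
  have low: "h c \<le> h w" if "c \<in> children x" for c using h_child[OF x(1) that] w(2) by simp
  from x(1) uv(1,2) show ?thesis
  proof (cases rule: pair_cases)
    case root
    then show ?thesis using uv N_pos[OF x(1)] by simp
  next
    case (path c)
    then show ?thesis using uv(3) tight_h[OF ch[OF path(1)]] N_child[OF x(1) path(1)] by linarith
  next
    case (child c)
    then have "3 * d u v \<le> 2 * N c + 2" using ch unfolding tight_def by blast
    then show ?thesis using uv(3) N_child[OF x(1) child(1)] by linarith
  next
    case (two y z)
    show ?thesis
    proof (cases "z = w")
      case True
      then show ?thesis using that[of y] two uv(3) by (auto simp: add.commute)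
    next
      case False
      then show ?thesis using that[of z] two uv(3) low[of y] by auto
    qed
  qed
qed

text \<open>The upper bounds for the heights of \<open>w\<close> and \<open>z\<close> and the count
  of vertices add up to \<open>3 * (h w + h z + 2) \<le> 2 * N x + 1\<close>. This meets the lower
  bound of \<open>far_children_mod_1\<close>, so every inequality used is an equality.\<close>

lemma tallest_child_mod_1:
  assumes x: "x \<in> V" "tight x" and mod: "N x mod 3 = 1"
    and ch: "\<And>c. c \<in> children x \<Longrightarrow> tight c"
    and w: "w \<in> children x" "h x = Suc (h w)" "N w mod 3 = 1"
  obtains z where "z \<in> children x" "z \<noteq> w" "3 * h w + 2 = 2 * N w" "3 * h z + 1 = 2 * N z"
    "N x = N w + N z + 1"
proof -
  obtain z where z: "z \<in> children x" "z \<noteq> w" "3 * (h w + h z + 2) \<ge> 2 * N x + 1"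
    using far_children_mod_1[OF x mod ch w(1,2)] by blast
  have "3 * h w + 2 \<le> 2 * N w" using tight_h_mod_1 ch w by blast
  moreover have "3 * h z + 1 \<le> 2 * N z" using tight_h ch z by blast
  moreover have "N w + N z + 1 \<le> N x" using N_children x w z by blast
  ultimately have "3 * h w + 2 = 2 * N w \<and> 3 * h z + 1 = 2 * N z \<and> N x = N w + N z + 1"
    using z(3) by simp
  with z that show ?thesis by blast
qed

section \<open>Tall subtrees and their deepest vertices\<close>

definition deepest :: "'a \<Rightarrow> 'a set" where
  "deepest x = {v \<in> T x. d x v = h x}"

lemma deepest_unique_tallest:
  assumes x: "x \<in> V" and w: "w \<in> children x" "h x = Suc (h w)"
    and uniq: "\<And>c. c \<in> children x \<Longrightarrow> c \<noteq> w \<Longrightarrow> h c < h w"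
  shows "deepest x \<subseteq> deepest w"
proof
  fix v assume "v \<in> deepest x"
  then have v: "v \<in> T x" "d x v = h x" unfolding deepest_def by auto
  then have "v \<noteq> x" using w(2) by auto
  then obtain c where c: "c \<in> children x" "v \<in> T c" using v T_decomp[OF x] by blast
  then have "d c v = h w" using d_child[OF x c] v w by simp
  moreover from this have "c = w" using uniq[OF c(1)] d_le_h[OF c(2)] by fastforce
  ultimately show "v \<in> deepest w" using c unfolding deepest_def by simp
qed

lemma finite_deepest [simp]: "finite (deepest x)"
  unfolding deepest_def by simp

text \<open>The last hypothesis makes \<open>T x\<close> nearly as tall as its order permits. A
  second tallest child would require too many vertices, so all deepest vertices lie below a single
  child, where the induction continues.\<close>

lemma card_deepest_le_1:
  assumes "x \<in> V" "\<And>y. y \<in> V \<Longrightarrow> N y \<le> N x \<Longrightarrow> tight y" "3 * h x + 2 \<ge> 2 * N x"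
  shows "card (deepest x) \<le> 1"
  using assms
proof (induction "h x" arbitrary: x)
  case 0
  then have "deepest x \<subseteq> {x}" unfolding deepest_def using d_eq_0 T_V by fastforce
  then show ?case using card_mono[of "{x}" "deepest x"] by simp
next
  case (Suc m)
  note x = \<open>x \<in> V\<close>
  obtain w where w: "w \<in> children x" "h w = m" using tallest_child[OF x] Suc.hyps(2) by metis
  have ch: "tight c" if "c \<in> children x" for c
    using Suc.prems(2)[of c] N_child[OF x that] children_V[OF that] by simp
  have "h c < h w" if c: "c \<in> children x" "c \<noteq> w" for c
  proof (rule ccontr)
    assume "\<not> h c < h w"
    then have "h c = m" using h_child[OF x c(1)] Suc.hyps(2) w by simp
    then have "3 * m + 1 \<le> 2 * N c" "3 * m + 1 \<le> 2 * N w"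
      using tight_h[OF ch[OF c(1)]] tight_h[OF ch[OF w(1)]] w(2) by simp_all
    moreover have "N c + N w + 1 \<le> N x" using N_children[OF x c(1) w(1) c(2)] .
    moreover have "N x \<noteq> 3" using tight_simps(1)[OF Suc.prems(2)[OF x]] by auto
    ultimately show False using Suc.prems(3) Suc.hyps(2)
      N_pos[OF children_V[OF c(1)]] N_pos[OF children_V[OF w(1)]] by linarith
  qed
  then have "deepest x \<subseteq> deepest w" using deepest_unique_tallest[OF x w(1)] w Suc.hyps(2) by simp
  moreover have "card (deepest w) \<le> 1"
  proof (rule Suc.hyps(1))
    show "m = h w" "w \<in> V" using w children_V by auto
    show "tight y" if "y \<in> V" "N y \<le> N w" for y
      using Suc.prems(2)[of y] that N_child[OF x w(1)] by simp
    \<comment> \<open>The descent to \<open>w\<close> loses one unit of the hypothesis, which the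
      residue of \<open>N w\<close> gives back.\<close>
    have "2 * N w \<le> 3 * h w + 3" using Suc.prems(3) Suc.hyps(2) N_child[OF x w(1)] w(2) by simp
    then show "3 * h w + 2 \<ge> 2 * N w" using mod_3_nonzero(3) tight_simps(1)[OF ch[OF w(1)]] by blast
  qed
  ultimately show ?case using card_mono[of "deepest w" "deepest x"] by simp
qed

text \<open>Residue 2 would bound \<open>N x\<close> or \<open>N w\<close> by \<open>k\<close>, too
  little for their heights, so both residues are 1 and \<open>tallest_child_mod_1\<close> yields
  equalities. One level further down, at \<open>y\<close>, the residue is 2; order at most
  \<open>k\<close> and height at least \<open>k - 2\<close> then leave only small numbers.\<close>

lemma exceptional_subtree:
  assumes x: "x \<in> V" and below: "\<And>y. y \<in> V \<Longrightarrow> N y \<le> N x \<Longrightarrow> tight y" and high: "h x \<ge> k"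
  shows "h x = k" "k = 3 \<and> N x = 7 \<or> k = 5 \<and> N x = 10" "card (deepest x) \<le> 1"
proof -
  have tight: "tight x" using below x by simp
  have mod: "N x mod 3 = 1"
    using tight_mod_cases[OF tight] N_le_mod_2[OF x tight] tight_h[OF tight] high k by auto
  have ch: "tight c" if "c \<in> children x" for c
    using below[of c] N_child[OF x that] children_V[OF that] by simp
  obtain w where w: "w \<in> children x" "h x = Suc (h w)"
  proof -
    have "h x = Suc (h x - 1)" using high k by simp
    then show ?thesis using tallest_child[OF x] that by metis
  qed
  have wV: "w \<in> V" using w children_V by blast
  have tight_w: "tight w" using ch w by blast
  have mod_w: "N w mod 3 = 1"
    using tight_mod_cases[OF tight_w] N_le_mod_2[OF wV tight_w] tight_h[OF tight_w] high w k by auto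
  obtain z where z: "z \<in> children x" "z \<noteq> w" "3 * h w + 2 = 2 * N w" "3 * h z + 1 = 2 * N z"
    "N x = N w + N z + 1"
    using tallest_child_mod_1[OF x tight mod ch w mod_w] by blast
  have ch_w: "tight c" if "c \<in> children w" for c
    using below[of c] N_child[OF wV that] N_child[OF x w(1)] children_V[OF that] by simp
  obtain y where y: "y \<in> children w" "h w = Suc (h y)"
  proof -
    have "h w = Suc (h w - 1)" using high k w by simp
    then show ?thesis using tallest_child[OF wV] that by metis
  qed
  have yV: "y \<in> V" using y children_V by blast
  have tight_y: "tight y" using ch_w y by blast
  \<comment> \<open>Equalities for both \<open>w\<close> and \<open>y\<close> would make
    \<open>2 * N z'\<close> odd.\<close>
  have "N y mod 3 \<noteq> 1"
  proof
    assume "N y mod 3 = 1"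
    then obtain z' where "3 * h y + 2 = 2 * N y" "3 * h z' + 1 = 2 * N z'" "N w = N y + N z' + 1"
      using tallest_child_mod_1[OF wV tight_w mod_w ch_w y] by blast
    then have "2 * N z' = 1" using z(3) y(2) by linarith
    then show False by presburger
  qed
  then have mod_y: "N y mod 3 = 2" using tight_mod_cases[OF tight_y] by blast
  have Ny: "N y \<le> k" using N_le_mod_2[OF yV tight_y mod_y] .
  have hy: "3 * h y + 1 \<le> 2 * N y" using tight_h[OF tight_y] .
  have hyk: "h y + 2 \<ge> k" using high w y by simp
  have Nx: "N x \<le> 2 * k + 1" using N_le_mod_1[OF x tight mod] .
  have *: "Suc (h w) = k \<and> (k = 3 \<and> N x = 7 \<or> k = 5 \<and> N x = 10) \<and> h z < h w"
    using exceptional_numbers[OF k Ny mod_y hy hyk y(2) z(3,4,5) Nx mod] .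
  then show "h x = k" "k = 3 \<and> N x = 7 \<or> k = 5 \<and> N x = 10" using w(2) by auto
  have "h c < h w" if c: "c \<in> children x" "c \<noteq> w" for c
  proof (cases "c = z")
    case True then show ?thesis using * by simp
  next
    case False
    \<comment> \<open>\<open>N x = N w + N z + 1\<close> leaves no room for a third child.\<close>
    then have "Suc (\<Sum>c\<in>{w, z, c}. N c) \<le> N x" using w z c by (intro sum_N_le[OF x]) auto
    then show ?thesis using False c z N_pos[OF children_V[OF c(1)]] by simp
  qed
  then have "deepest x \<subseteq> deepest w" using deepest_unique_tallest[OF x w] by blast
  moreover have "card (deepest w) \<le> 1"
    using card_deepest_le_1[OF wV] below N_child[OF x w(1)] z(3) by simp
  ultimately show "card (deepest x) \<le> 1" using card_mono[of "deepest w" "deepest x"] by simp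
qed

text \<open>The ball of radius \<open>k\<close> at \<open>x\<close> misses only the vertices at
  distance \<open>k + 1\<close>. These are deepest vertices of children of height \<open>k\<close>,
  at most one for each, so with \<open>q\<close> such children the cost is at most
  \<open>k + q\<close>.\<close>

lemma reducible_exceptional:
  assumes x: "x \<in> V" and k35: "k = 3 \<and> n = 7 \<or> k = 5 \<and> n = 10"
    and ch: "\<And>c. c \<in> children x \<Longrightarrow> tight c \<and> h c \<le> k"
    and exc: "\<And>c. c \<in> children x \<Longrightarrow> h c = k \<Longrightarrow> N c = n \<and> card (deepest c) \<le> 1"
    and y: "y \<in> children x" "h y = k" and z: "z \<in> children x" "z \<noteq> y" "h z + 1 \<ge> k"
  shows "reducible k x"
proof -
  define Q where "Q = {c \<in> children x. h c = k}"
  define q where "q = card Q"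
  define L where "L = {v \<in> T x. d x v = Suc k}"
  have finQ: "finite Q" unfolding Q_def by simp
  have yQ: "y \<in> Q" using y unfolding Q_def by simp
  have "L \<subseteq> (\<Union>c\<in>Q. deepest c)"
  proof
    fix v assume "v \<in> L"
    then have v: "v \<in> T x" "d x v = Suc k" unfolding L_def by auto
    then have "v \<noteq> x" by auto
    then obtain c where c: "c \<in> children x" "v \<in> T c" using v T_decomp[OF x] by blast
    then have "d c v = k" using d_child[OF x c] v by simp
    moreover from this have "h c = k" using ch[OF c(1)] d_le_h[OF c(2)] by simp
    ultimately show "v \<in> (\<Union>c\<in>Q. deepest c)" using c unfolding Q_def deepest_def by auto
  qed
  then have "card L \<le> card (\<Union>c\<in>Q. deepest c)" using finQ by (intro card_mono) auto
  also have "\<dots> \<le> (\<Sum>c\<in>Q. card (deepest c))" by (rule card_UN_le[OF finQ])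
  also have "\<dots> \<le> (\<Sum>c\<in>Q. 1)" using exc unfolding Q_def by (intro sum_mono) auto
  finally have L: "card L \<le> q" unfolding q_def by simp
  have sumQ: "(\<Sum>c\<in>Q. N c) = q * n" unfolding q_def using exc unfolding Q_def by simp
  \<comment> \<open>The vertices below \<open>y\<close> alone do not pay for the ball; the count
    needs those below \<open>z\<close>, which is either another child of height \<open>k\<close> or
    has height \<open>k - 1\<close>.\<close>
  have size: "3 * (k + 1) * (k + q) \<le> (k + 2) * N x"
  proof (cases "h z = k")
    case True
    then have "{y, z} \<subseteq> Q" using yQ z unfolding Q_def by simp
    then have "q \<ge> 2" unfolding q_def using card_mono[OF finQ, of "{y, z}"] z by simp
    moreover have "Suc (q * n) \<le> N x" using sum_N_le[OF x, of Q] sumQ unfolding Q_def by auto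
    ultimately show ?thesis using k35 by auto
  next
    case False
    then have hz: "h z + 1 = k" using z ch[OF z(1)] by simp
    then have "z \<notin> Q" unfolding Q_def by simp
    moreover have "Suc (\<Sum>c\<in>insert z Q. N c) \<le> N x" using z by (intro sum_N_le[OF x]) (auto simp: Q_def)
    ultimately have "Suc (N z + q * n) \<le> N x" using finQ sumQ by simp
    moreover have "q \<ge> 1" unfolding q_def using yQ finQ by (simp add: Suc_le_eq card_gt_0_iff) blast
    moreover have "3 * h z + 1 \<le> 2 * N z" using tight_h ch z by blast
    ultimately show ?thesis using k35 hz by auto
  qed
  define g where "g = (\<lambda>v. if v = x then k else if v \<in> L then 1 else (0::nat))"
  have xL: "x \<notin> L" unfolding L_def by simp
  have "sum g (T x) = k + card L"
  proof -
    have "sum g (T x) = g x + sum g (T x - {x})" using T_self[OF x] by (simp add: sum.remove)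
    also have "sum g (T x - {x}) = (\<Sum>v\<in>T x - {x}. if v \<in> L then 1 else 0)"
      by (intro sum.cong) (auto simp: g_def)
    also have "\<dots> = card ((T x - {x}) \<inter> L)" by (simp add: sum.If_cases)
    also have "(T x - {x}) \<inter> L = L" using xL unfolding L_def by auto
    finally show ?thesis by (simp add: g_def)
  qed
  then have "3 * (k + 1) * sum g (T x) \<le> 3 * (k + 1) * (k + q)"
    using L by (intro mult_le_mono2) simp
  then have cost: "3 * (k + 1) * sum g (T x) \<le> (k + 2) * N x" using size by (rule order_trans)
  have dom: "\<exists>v\<in>T x. 1 \<le> g v \<and> d u v \<le> g v" if u: "u \<in> T x" for u
  proof (cases "d x u \<le> k")
    case True
    then have "d u x \<le> k" using d_commute[of u x] u T_V x by fastforce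
    then show ?thesis using T_self[OF x] k by (intro bexI[of _ x]) (auto simp: g_def)
  next
    case False
    then have "u \<noteq> x" by auto
    then obtain c where c: "c \<in> children x" "u \<in> T c" using u T_decomp[OF x] by blast
    then have "d x u = Suc k" using d_child[OF x c] d_le_h[OF c(2)] ch[OF c(1)] False by simp
    then have "u \<in> L" using u unfolding L_def by simp
    then show ?thesis using u \<open>u \<noteq> x\<close> by (intro bexI[of _ u]) (auto simp: g_def)
  qed
  show ?thesis unfolding reducible_def
    using cost dom T_self[OF x] k by (intro exI[of _ g]) (auto simp: g_def L_def)
qed

text \<open>The induction is on the order and not just over children, since
  \<open>exceptional_subtree\<close> asks for tightness of every vertex whose subtree is no larger
  than the given one.\<close>

lemma all_tight: "x \<in> V \<Longrightarrow> tight x"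
proof (induction "N x" arbitrary: x rule: less_induct)
  case less
  note x = \<open>x \<in> V\<close>
  have below: "tight y" if "y \<in> V" "N y < N x" for y using less.hyps that by blast
  have ch: "tight c" if "c \<in> children x" for c
    using below[of c] N_child[OF x that] children_V[OF that] by simp
  have hx: "3 * h x \<le> 2 * N x"
  proof (cases "h x")
    case (Suc m)
    then obtain w where w: "w \<in> children x" "h w = m" using tallest_child[OF x] by metis
    then show ?thesis using tight_h[OF ch[OF w(1)]] N_child[OF x w(1)] Suc by simp
  qed simp
  have dx: "3 * d u v \<le> 2 * N x + 2" if "u \<in> T x" "v \<in> T x" for u v
    using x that
  proof (cases rule: pair_cases)
    case (path c)
    then show ?thesis using tight_h[OF ch[OF path(1)]] N_child[OF x path(1)] by linarith
  next
    case (child c)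
    then have "3 * d u v \<le> 2 * N c + 2" using ch unfolding tight_def by blast
    then show ?thesis using N_child[OF x child(1)] by linarith
  next
    case (two y z)
    then show ?thesis
      using tight_h[OF ch[OF two(1)]] tight_h[OF ch[OF two(2)]] N_children[OF x two(1-3)] by linarith
  qed simp
  have exc: "h c = k" "k = 3 \<and> N c = 7 \<or> k = 5 \<and> N c = 10" "card (deepest c) \<le> 1"
    if "c \<in> children x" "h c \<ge> k" for c
    using exceptional_subtree[OF children_V[OF that(1)] _ that(2)] below N_child[OF x that(1)] by auto
  have hc: "h c \<le> k" if "c \<in> children x" for c using exc(1)[OF that] by linarith
  have dk: "d u v \<le> 2 * k" if "u \<in> T x" "v \<in> T x" for u v
    using x that
  proof (cases rule: pair_cases)
    case (path c)
    then show ?thesis using hc[OF path(1)] k by linarith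
  next
    case (child c)
    then show ?thesis using ch unfolding tight_def by blast
  next
    case (two y z)
    show ?thesis
    proof (rule ccontr)
      assume far: "\<not> d u v \<le> 2 * k"
      \<comment> \<open>A distance above \<open>2 * k\<close> through \<open>x\<close> requires
        \<open>h y + h z \<ge> 2 * k - 1\<close>, while no child is higher than
        \<open>k\<close>.\<close>
      have "\<exists>y z. y \<in> children x \<and> z \<in> children x \<and> z \<noteq> y \<and> h y = k \<and> h z + 1 \<ge> k"
      proof (cases "h y = k")
        case True
        then show ?thesis using two far by (intro exI[of _ y] exI[of _ z]) auto
      next
        case False
        then have "h z = k" "h y + 1 \<ge> k" using hc[OF two(1)] hc[OF two(2)] two(4) far by linarith+
        then show ?thesis using two by (intro exI[of _ z] exI[of _ y]) auto
      qed
      then obtain y z where yz: "y \<in> children x" "z \<in> children x" "z \<noteq> y" "h y = k" "h z + 1 \<ge> k"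
        by blast
      have "reducible k x"
      proof (rule reducible_exceptional[OF x _ _ _ yz(1,4,2,3,5)])
        show n: "k = 3 \<and> N y = 7 \<or> k = 5 \<and> N y = 10" using exc(2) yz by simp
        show "tight c \<and> h c \<le> k" if "c \<in> children x" for c using ch hc that by blast
        show "N c = N y \<and> card (deepest c) \<le> 1" if "c \<in> children x" "h c = k" for c
          using exc(2,3)[OF that(1)] that n by auto
      qed
      then show False using irreducible x by blast
    qed
  qed simp
  have "N x mod 3 \<noteq> 0"
  proof
    assume "N x mod 3 = 0"
    then obtain r where r: "N x = 3 * r" by (metis mod_0_imp_dvd dvdE)
    then have "r \<ge> 1" using N_pos[OF x] by simp
    moreover have "d u v \<le> 2 * r \<and> d u v \<le> 2 * k" if "u \<in> T x" "v \<in> T x" for u v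
      using dx[OF that] dk[OF that] r by simp
    ultimately have "(k + 2) * N x < 3 * (k + 1) * r" using no_cheap_ball[OF x] by blast
    then show False using r by (simp add: algebra_simps)
  qed
  then show ?case unfolding tight_def using hx dx dk by blast
qed

lemma irreducible_broadcast:
  obtains g where "\<And>v. g v \<le> k" "\<And>u. u \<in> V \<Longrightarrow> \<exists>v\<in>V. 1 \<le> g v \<and> d u v \<le> g v"
    "3 * sum g V \<le> card V + 2"
proof -
  define n where "n = card V"
  have n: "N root = n" unfolding N_def n_def T_root ..
  have n1: "n \<ge> 1" using N_pos[OF root] n by simp
  \<comment> \<open>\<open>(n + 2) div 3\<close> is \<open>n / 3\<close> rounded up.\<close>
  define r where "r = min k ((n + 2) div 3)"
  have r: "1 \<le> r" "r \<le> k" "3 * r \<le> n + 2" using n1 k unfolding r_def by auto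
  have "d u v \<le> 2 * r" if "u \<in> T root" "v \<in> T root" for u v
  proof -
    have "3 * d u v \<le> 2 * n + 2" "d u v \<le> 2 * k"
      using all_tight[OF root] that n unfolding tight_def by auto
    moreover from this have "d u v \<le> 2 * ((n + 2) div 3)" by presburger
    ultimately show ?thesis unfolding r_def by simp
  qed
  then show ?thesis
    using ball_broadcast[OF root r(1,2)] that r(3) unfolding T_root n_def by metis
qed

end

section \<open>Induction by removing subtrees, and the final bound\<close>

text \<open>The constant \<open>3 * k + 2\<close> is the largest that the final rounding up permits.
  It is spent at most once, on a remaining tree without reducible vertices; each removed subtree
  pays for itself.\<close>

theorem tree_broadcast:
  fixes V :: "'a set"
  assumes "tree V E" "k \<ge> 3"
  shows "\<exists>f. dominating_k_broadcast V E k f \<and>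
    3 * (k + 1) * broadcast_cost V f \<le> (k + 2) * card V + 3 * k + 2"
  using assms(1)
proof (induction "card V" arbitrary: V E rule: less_induct)
  case less
  obtain root where root: "root \<in> V" using less.prems unfolding tree_def simple_graph_def by blast
  interpret rooted_tree V E root using less.prems root by unfold_locales
  show ?case
  proof (cases "\<exists>x\<in>V. reducible k x")
    case False
    then interpret irreducible_tree V E root k using assms(2) by unfold_locales auto
    obtain g where g: "\<And>v. g v \<le> k" "\<And>u. u \<in> V \<Longrightarrow> \<exists>v\<in>V. 1 \<le> g v \<and> d u v \<le> g v"
      "3 * sum g V \<le> card V + 2" using irreducible_broadcast by blast
    have "3 * (k + 1) * sum g V \<le> (k + 1) * (card V + 2)"
      using mult_le_mono2[OF g(3), of "k + 1"] by (simp only: mult.assoc mult.left_commute)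
    also have "\<dots> \<le> (k + 2) * card V + 3 * k + 2" by (simp add: algebra_simps)
    finally show ?thesis
      using g unfolding dominating_k_broadcast_def broadcast_cost_def by blast
  next
    case True
    then obtain x g where x: "x \<in> V" and g: "\<And>v. v \<notin> T x \<Longrightarrow> g v = 0" "\<And>v. g v \<le> k"
      "\<And>u. u \<in> T x \<Longrightarrow> \<exists>v\<in>T x. 1 \<le> g v \<and> d u v \<le> g v"
      "3 * (k + 1) * sum g (T x) \<le> (k + 2) * N x"
      unfolding reducible_def by blast
    show ?thesis
    proof (cases "x = root")
      case True
      then have "3 * (k + 1) * sum g V \<le> (k + 2) * card V + 3 * k + 2"
        using g(4) unfolding N_def by (simp add: T_root)
      moreover have "dominating_k_broadcast V E k g"
        unfolding dominating_k_broadcast_def using g(2,3) True T_root by auto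
      ultimately show ?thesis unfolding broadcast_cost_def by blast
    next
      case False
      define V' where "V' = V - T x"
      define E' where "E' = (\<lambda>u v. E u v \<and> u \<notin> T x \<and> v \<notin> T x)"
      have tree': "tree V' E'" unfolding V'_def E'_def by (rule remove_subtree[OF x False])
      have cardV: "card V = card V' + N x"
        unfolding V'_def N_def using T_V[of x] finite_V card_mono[of V "T x"]
        by (simp add: card_Diff_subset)
      then have "card V' < card V" using N_pos[OF x] by simp
      then obtain f where f: "dominating_k_broadcast V' E' k f"
        "3 * (k + 1) * broadcast_cost V' f \<le> (k + 2) * card V' + 3 * k + 2"
        using less.hyps tree' by blast
      \<comment> \<open>Provides \<open>dist_relpowp\<close> for the smaller tree; any root will
        do.\<close>
      interpret rest: rooted_tree V' E' "SOME v. v \<in> V'"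
        using tree' by unfold_locales (auto simp: tree_def simple_graph_def some_in_eq)
      \<comment> \<open>Removing vertices can only lengthen distances, so \<open>f\<close> still
        dominates \<open>V'\<close> in the whole tree.\<close>
      have d_le: "d u v \<le> dist E' u v" if "u \<in> V'" "v \<in> V'" for u v
      proof -
        have "(E ^^ dist E' u v) u v"
          using relpowp_mono[of E' E, OF _ rest.dist_relpowp[OF that]] unfolding E'_def by blast
        then show ?thesis by (rule dist_le_relpowp)
      qed
      define F where "F = (\<lambda>v. if v \<in> V' then f v else g v)"
      have "dominating_k_broadcast V E k F"
        unfolding dominating_k_broadcast_def
      proof (intro conjI ballI)
        show "F v \<le> k" if "v \<in> V" for v
          using f(1) g(2) unfolding F_def dominating_k_broadcast_def by simp
        show "\<exists>v\<in>V. 1 \<le> F v \<and> d u v \<le> F v" if "u \<in> V" for u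
        proof (cases "u \<in> V'")
          case True
          then obtain v where v: "v \<in> V'" "1 \<le> f v" "dist E' u v \<le> f v"
            using f(1) unfolding dominating_k_broadcast_def by blast
          moreover have "v \<in> V" using v unfolding V'_def by simp
          ultimately show ?thesis using d_le[OF True v(1)] unfolding F_def by (intro bexI[of _ v]) auto
        next
          case False
          then have "u \<in> T x" using that unfolding V'_def by simp
          then obtain v where v: "v \<in> T x" "1 \<le> g v" "d u v \<le> g v" using g(3) by blast
          then have "v \<in> V" "v \<notin> V'" using T_V unfolding V'_def by auto
          then show ?thesis using v unfolding F_def by (intro bexI[of _ v]) auto
        qed
      qed
      moreover have "broadcast_cost V F = broadcast_cost V' f + sum g (T x)"
      proof -
        have "sum F V = sum F V' + sum F (T x)"
          using sum.subset_diff[OF T_V finite_V] unfolding V'_def .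
        also have "sum F V' = sum f V'" unfolding F_def by simp
        also have "sum F (T x) = sum g (T x)" unfolding F_def V'_def by (intro sum.cong) auto
        finally show ?thesis unfolding broadcast_cost_def .
      qed
      ultimately show ?thesis using f(2) g(4) cardV by (intro exI[of _ F]) (simp add: algebra_simps)
    qed
  qed
qed

theorem theorem3:
  fixes V :: "'a set" and E :: "'a \<Rightarrow> 'a \<Rightarrow> bool" and n k :: nat
  assumes "tree V E"
    and "card V = n"
    and "k \<ge> 3"
    and "k < radius V E"
  shows "real (broadcast_number V E k)
           \<le> real_of_int \<lceil>(real (k + 2) / real (k + 1)) * (real n / 3)\<rceil>"
proof -
  obtain f where f: "dominating_k_broadcast V E k f"
    "3 * (k + 1) * broadcast_cost V f \<le> (k + 2) * n + 3 * k + 2"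
    using tree_broadcast[OF assms(1,3)] assms(2) by blast
  define b where "b = broadcast_number V E k"
  have "b \<le> broadcast_cost V f"
    unfolding b_def broadcast_number_def using f(1) by (intro Least_le) blast
  then have "3 * (k + 1) * b \<le> 3 * (k + 1) * broadcast_cost V f" by (rule mult_le_mono2)
  also note f(2)
  \<comment> \<open>Strictness matters: \<open>b\<close> exceeds the unrounded bound by less than 1,
    so the integer \<open>b\<close> is at most its ceiling.\<close>
  also have "(k + 2) * n + 3 * k + 2 < (k + 2) * n + 3 * (k + 1)" by simp
  finally have "real (3 * (k + 1) * b) < real ((k + 2) * n + 3 * (k + 1))" by (simp only: of_nat_less_iff)
  then have "real b - 1 < (real (k + 2) / real (k + 1)) * (real n / 3)"
    by (simp add: field_simps)
  then have "int b \<le> \<lceil>(real (k + 2) / real (k + 1)) * (real n / 3)\<rceil>" by linarith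
  then show ?thesis unfolding b_def by linarith
qed

end
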